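(* Let $\alpha \in [0,1]$, let $\mathbb{T}$ be a time scale, and let $a, b \in \mathbb{T}$ with $a < b$. Let $f, g : [a,b]\cap\mathbb{T} \to \mathbb{R}$ be continuous functions and let $\varphi, \Phi, \gamma, \Gamma \in \mathbb{R}$ be constants such that $\varphi \leq f(t) \leq \Phi$ and $\gamma \leq g(t) \leq \Gamma$ for all $t \in [a,b]\cap \mathbb{T}$. Then $$ \left|\frac{1}{b-a}\int_{a}^{b}f(t) g(t)\,\diamondsuit_{\alpha}t - \frac{1}{(b-a)^{2}}\int_{a}^{b}f(t)\, \diamondsuit_{\alpha}t \int_{a}^{b}g(t)\, \diamondsuit_{\alpha}t \right| \leq \frac{1}{4}(\Phi-\varphi)(\Gamma-\gamma). $$
   Context: A time scale $\mathbb{T}$ is a nonempty closed subset of $\mathbb{R}$, with the subspace topology. The forward and backward jump operators are $\sigma(t)=\inf\{s\in\mathbb{T}: s>t\}$ and $\rho(t)=\sup\{s\in\mathbb{T}: s<t\}$, with the usual conventions $\sigma(t)=t$ if $t=\max\mathbb{T}$ and $\rho(t)=t$ if $t=\min\mathbb{T}$. A point $t$ is right-scattered if $\sigma(t)>t$ and left-scattered if $\rho(t)<t$. The set $\mathbb{T}^k$ is $\mathbb{T}$ minus its maximum if $\mathbb{T}$ has a left-scattered maximum, and $\mathbb{T}^k=\mathbb{T}$ otherwise; $\mathbb{T}_k$ is $\mathbb{T}$ minus its minimum if $\mathbb{T}$ has a right-scattered minimum, and $\mathbb{T}_k=\mathbb{T}$ otherwise. For $f:\mathbb{T}\to\mathbb{R}$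 and $t\in\mathbb{T}^k$, the delta derivative $f^\Delta(t)$ is the number (if it exists) such that for every $\epsilon>0$ there is a neighborhood $U$ of $t$ in $\mathbb{T}$ with $|f(\sigma(t))-f(s)-f^\Delta(t)(\sigma(t)-s)|\le\epsilon|\sigma(t)-s|$ for all $s\in U$. For $t\in\mathbb{T}_k$, the nabla derivative $f^\nabla(t)$ is the number (if it exists) such that for every $\epsilon>0$ there is a neighborhood $V$ of $t$ in $\mathbb{T}$ with $|f(\rho(t))-f(s)-f^\nabla(t)(\rho(t)-s)|\le\epsilon|\rho(t)-s|$ for all $s\in V$. If $F^\Delta=f$ on $\mathbb{T}^k$, the delta integral is $\int_a^b f(t)\,\Delta t=F(b)-F(a)$. If $G^\nabla=f$ on $\mathbb{T}_k$, the nabla integral is $\int_a^b f(t)\,\nabla t=G(b)-G(a)$. For $0\le\alpha\le1$ the diamond-$\alpha$ integral is $$\int_a^b f(t)\,\diamondsuit_\alpha t=\alpha\int_a^b f(t)\,\Delta t+(1-\alpha)\int_a^b f(t)\,\nabla t.$$ Continuous functions have delta and nabla antiderivatives. For a function given only on $[a,b]\cap\mathbb{T}$, the integrals from $a$ to $b$ are those computed on the time scale $[a,b]\cap\mathbb{T}$. *)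

theory Defs
  imports "HOL-Analysis.Analysis"
begin

definition time_scale :: "real set \<Rightarrow> bool" where
  "time_scale T \<longleftrightarrow> T \<noteq> {} \<and> closed T"

definition forward_jump :: "real set \<Rightarrow> real \<Rightarrow> real" where
  "forward_jump T t = (if \<forall>s\<in>T. s \<le> t then t else Inf {s \<in> T. s > t})"

definition backward_jump :: "real set \<Rightarrow> real \<Rightarrow> real" where
  "backward_jump T t = (if \<forall>s\<in>T. t \<le> s then t else Sup {s \<in> T. s < t})"

definition right_scattered :: "real set \<Rightarrow> real \<Rightarrow> bool" where
  "right_scattered T t \<longleftrightarrow> forward_jump T t > t"

definition left_scattered :: "real set \<Rightarrow> real \<Rightarrow> bool" where
  "left_scattered T t \<longleftrightarrow> backward_jump T t < t"

definition upper_kappa :: "real set \<Rightarrow> real set" where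
  "upper_kappa T = T - {m \<in> T. (\<forall>s\<in>T. s \<le> m) \<and> left_scattered T m}"

definition lower_kappa :: "real set \<Rightarrow> real set" where
  "lower_kappa T = T - {m \<in> T. (\<forall>s\<in>T. m \<le> s) \<and> right_scattered T m}"

text \<open>
  A function on a time scale \<open>T\<close> is represented by a total function on the reals of which only
  the values on \<open>T\<close> matter: on \<open>T\<close> the jump operators take values in \<open>T\<close>. The number \<open>D\<close> below
  is unique for \<open>t\<close> in \<open>upper_kappa T\<close> (respectively \<open>lower_kappa T\<close>) as soon as \<open>T\<close> has at
  least two points.
\<close>

definition has_delta_derivative :: "real set \<Rightarrow> (real \<Rightarrow> real) \<Rightarrow> real \<Rightarrow> real \<Rightarrow> bool" where
  "has_delta_derivative T f D t \<longleftrightarrow>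
     (\<forall>\<epsilon>>0. \<exists>U. openin (top_of_set T) U \<and> t \<in> U \<and>
        (\<forall>s\<in>U. \<bar>f (forward_jump T t) - f s - D * (forward_jump T t - s)\<bar>
                 \<le> \<epsilon> * \<bar>forward_jump T t - s\<bar>))"

definition has_nabla_derivative :: "real set \<Rightarrow> (real \<Rightarrow> real) \<Rightarrow> real \<Rightarrow> real \<Rightarrow> bool" where
  "has_nabla_derivative T f D t \<longleftrightarrow>
     (\<forall>\<epsilon>>0. \<exists>V. openin (top_of_set T) V \<and> t \<in> V \<and>
        (\<forall>s\<in>V. \<bar>f (backward_jump T t) - f s - D * (backward_jump T t - s)\<bar>
                 \<le> \<epsilon> * \<bar>backward_jump T t - s\<bar>))"

definition delta_antiderivative :: "real set \<Rightarrow> (real \<Rightarrow> real) \<Rightarrow> (real \<Rightarrow> real) \<Rightarrow> bool" where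
  "delta_antiderivative T F f \<longleftrightarrow> (\<forall>t\<in>upper_kappa T. has_delta_derivative T F (f t) t)"

definition nabla_antiderivative :: "real set \<Rightarrow> (real \<Rightarrow> real) \<Rightarrow> (real \<Rightarrow> real) \<Rightarrow> bool" where
  "nabla_antiderivative T G f \<longleftrightarrow> (\<forall>t\<in>lower_kappa T. has_nabla_derivative T G (f t) t)"

text \<open>
  The increment of an antiderivative between two points of \<open>T\<close> does not depend on the choice of the antiderivative
  (when \<open>T\<close> has at least two points), so the descriptions below denote its common value
  whenever an antiderivative exists, in particular for \<open>f\<close> continuous on \<open>T\<close>. If there is none,
  the integral is an unspecified number.
\<close>

definition delta_integral :: "real set \<Rightarrow> real \<Rightarrow> real \<Rightarrow> (real \<Rightarrow> real) \<Rightarrow> real" where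
  "delta_integral T a b f = (THE I. \<exists>F. delta_antiderivative T F f \<and> I = F b - F a)"

definition nabla_integral :: "real set \<Rightarrow> real \<Rightarrow> real \<Rightarrow> (real \<Rightarrow> real) \<Rightarrow> real" where
  "nabla_integral T a b f = (THE I. \<exists>G. nabla_antiderivative T G f \<and> I = G b - G a)"

definition diamond_integral :: "real \<Rightarrow> real set \<Rightarrow> real \<Rightarrow> real \<Rightarrow> (real \<Rightarrow> real) \<Rightarrow> real" where
  "diamond_integral \<alpha> T a b f = \<alpha> * delta_integral T a b f + (1 - \<alpha>) * nabla_integral T a b f"

end

theory Submission imports Defs begin

text \<open>
  Write \<open>S\<close> for the part of the time scale in \<open>[a, b]\<close>. Once the diamond integral over \<open>S\<close>, divided
  by \<open>b - a\<close>, is known to be a linear functional on the continuous functions that is positive and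
  maps the constant 1 to 1, the theorem is the classical Gruess inequality. Such a functional
  behaves like an expectation: the left-hand side is a covariance, the Cauchy-Schwarz inequality
  bounds it by the two variances, and the variance of a function with values in \<open>[m, M]\<close> is at
  most \<open>(M - m)\<^sup>2 / 4\<close>, because the mean of the nonnegative function \<open>(M - f) (f - m)\<close> is
  nonnegative. See \<open>positive_mean.Gruess\<close>.

  Linearity and positivity are not visible in a definition by antiderivatives. They come from a
  formula in terms of an ordinary integral: sending every real \<open>x\<close> in \<open>[a, b]\<close> to the last point
  of \<open>S\<close> that does not exceed it extends \<open>f\<close> to a step-like function, constant on each gap of
  \<open>S\<close>, and the delta integral is the integral of this extension (\<open>delta_integral_eq\<close>). Two facts
  are behind this. The indefinite integral of the extension is a delta antiderivative of \<open>f\<close>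
  (\<open>delta_antiderivative_integral\<close>). And a function with vanishing delta derivative takes the same
  value at both ends of \<open>S\<close> (\<open>zero_delta_derivative_imp_eq\<close>), so that every other antiderivative
  has the same increment.

  The reflection \<open>t \<mapsto> - t\<close> exchanges the two jump operators and turns nabla integrals into delta
  integrals, and the diamond functional is a convex combination of the two.
\<close>

section \<open>Delta antiderivatives on a bounded time scale\<close>

lemma has_delta_derivative_diff:
  assumes "has_delta_derivative S F C t" and "has_delta_derivative S G D t"
  shows "has_delta_derivative S (\<lambda>x. F x - G x) (C - D) t"
  unfolding has_delta_derivative_def
proof (intro allI impI)
  fix \<epsilon> :: real
  assume "\<epsilon> > 0"
  then have "\<epsilon> / 2 > 0" by simp
  define \<sigma> where "\<sigma> = forward_jump S t"
  from assms(1) \<open>\<epsilon> / 2 > 0\<close> obtain U where U: "openin (top_of_set S) U" "t \<in> U"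
      "\<forall>s\<in>U. \<bar>F \<sigma> - F s - C * (\<sigma> - s)\<bar> \<le> \<epsilon> / 2 * \<bar>\<sigma> - s\<bar>"
    unfolding has_delta_derivative_def \<sigma>_def by meson
  from assms(2) \<open>\<epsilon> / 2 > 0\<close> obtain V where V: "openin (top_of_set S) V" "t \<in> V"
      "\<forall>s\<in>V. \<bar>G \<sigma> - G s - D * (\<sigma> - s)\<bar> \<le> \<epsilon> / 2 * \<bar>\<sigma> - s\<bar>"
    unfolding has_delta_derivative_def \<sigma>_def by meson
  have bound: "\<bar>F \<sigma> - G \<sigma> - (F s - G s) - (C - D) * (\<sigma> - s)\<bar> \<le> \<epsilon> * \<bar>\<sigma> - s\<bar>"
    if "s \<in> U \<inter> V" for s
  proof -
    have "F \<sigma> - G \<sigma> - (F s - G s) - (C - D) * (\<sigma> - s)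
        = (F \<sigma> - F s - C * (\<sigma> - s)) - (G \<sigma> - G s - D * (\<sigma> - s))"
      by (simp add: algebra_simps)
    moreover have "\<bar>F \<sigma> - F s - C * (\<sigma> - s)\<bar> \<le> \<epsilon> / 2 * \<bar>\<sigma> - s\<bar>" using U(3) that by blast
    moreover have "\<bar>G \<sigma> - G s - D * (\<sigma> - s)\<bar> \<le> \<epsilon> / 2 * \<bar>\<sigma> - s\<bar>" using V(3) that by blast
    ultimately show ?thesis by linarith
  qed
  show "\<exists>U. openin (top_of_set S) U \<and> t \<in> U \<and>
      (\<forall>s\<in>U. \<bar>F (forward_jump S t) - G (forward_jump S t) - (F s - G s)
                - (C - D) * (forward_jump S t - s)\<bar> \<le> \<epsilon> * \<bar>forward_jump S t - s\<bar>)"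
    unfolding \<sigma>_def[symmetric]
  proof (intro exI conjI ballI)
    show "openin (top_of_set S) (U \<inter> V)" using U(1) V(1) by (rule openin_Int)
    show "t \<in> U \<inter> V" using U(2) V(2) by (rule IntI)
  qed (rule bound)
qed

text \<open>
  The right end is left out of the bound on \<open>h\<close> because the integrands below are constant on a gap
  of the time scale only up to its right end, where they jump.
\<close>
lemma integral_near_constant:
  fixes h :: "real \<Rightarrow> real"
  assumes "p \<le> q" and "\<epsilon> \<ge> 0" and h: "h integrable_on {p..q}"
    and bound: "\<And>x. p \<le> x \<Longrightarrow> x < q \<Longrightarrow> \<bar>h x - c\<bar> \<le> \<epsilon>"
  shows "\<bar>integral {p..q} h - c * (q - p)\<bar> \<le> \<epsilon> * (q - p)"
proof -
  have "((\<lambda>x. h x - c) has_integral integral {p..q} h - (q - p) *\<^sub>R c) {p..q}"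
    using assms by (intro has_integral_diff integrable_integral) (use has_integral_const_real[of c p q] in auto)
  then have "norm (integral {p..q} h - (q - p) *\<^sub>R c) \<le> \<epsilon> * measure lborel (cbox p q)"
    using assms(2) bound
    by (intro has_integral_bound_spike_finite[of \<epsilon> "{q}"]) (auto simp: cbox_interval)
  then show ?thesis using assms(1) by (simp add: mult.commute)
qed

locale bounded_time_scale =
  fixes S :: "real set" and a b :: real
  assumes closed: "closed S" and subset: "S \<subseteq> {a..b}"
    and left_end: "a \<in> S" and right_end: "b \<in> S"
begin

lemma forward_jump_mem:
  assumes "t \<in> S" shows "forward_jump S t \<in> S"
proof (cases "\<forall>s\<in>S. s \<le> t")
  case False
  then have ne: "{s \<in> S. t < s} \<noteq> {}" by (auto simp: not_le)
  have bdd: "bdd_below {s \<in> S. t < s}" by (rule bdd_belowI[of _ t]) auto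
  have "Inf {s \<in> S. t < s} \<in> closure {s \<in> S. t < s}"
    by (rule closure_contains_Inf[OF ne bdd])
  also have "\<dots> \<subseteq> S" using closed by (intro closure_minimal) auto
  finally show ?thesis using False by (auto simp: forward_jump_def)
qed (use assms in \<open>auto simp: forward_jump_def\<close>)

lemma forward_jump_ge: "t \<le> forward_jump S t"
proof (cases "\<forall>s\<in>S. s \<le> t")
  case False
  then have ne: "{s \<in> S. t < s} \<noteq> {}" by (auto simp: not_le)
  then have "t \<le> Inf {s \<in> S. t < s}" by (rule cInf_greatest) auto
  then show ?thesis using False by (simp add: forward_jump_def)
qed (simp add: forward_jump_def)

lemma forward_jump_le:
  assumes "s \<in> S" and "t < s" shows "forward_jump S t \<le> s"
proof -
  have "bdd_below {s \<in> S. t < s}" by (rule bdd_belowI[of _ t]) auto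
  then have "Inf {s \<in> S. t < s} \<le> s" using assms by (intro cInf_lower) auto
  then show ?thesis using assms by (auto simp: forward_jump_def not_le)
qed

lemma upper_kappaI: "t \<in> S \<Longrightarrow> t < b \<Longrightarrow> t \<in> upper_kappa S"
  using right_end by (force simp: upper_kappa_def)

text \<open>
  This matters when \<open>c\<close> is the maximum of \<open>S\<close>: being left-dense, it is not removed.
\<close>
lemma left_dense_upper_kappa:
  assumes "c \<in> S" and "a < c" and "\<And>r. r < c \<Longrightarrow> \<exists>s\<in>S. r < s \<and> s < c"
  shows "c \<in> upper_kappa S"
proof -
  have "\<not> left_scattered S c"
  proof
    assume "left_scattered S c"
    then have "Sup {s \<in> S. s < c} < c"
      using assms(2) left_end by (auto simp: left_scattered_def backward_jump_def split: if_splits)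
    then obtain s where s: "s \<in> S" "Sup {s \<in> S. s < c} < s" "s < c" using assms(3) by blast
    have "bdd_above {s \<in> S. s < c}" by (rule bdd_aboveI[of _ c]) auto
    then have "s \<le> Sup {s \<in> S. s < c}" using s by (intro cSup_upper) auto
    with s show False by simp
  qed
  with assms show ?thesis by (auto simp: upper_kappa_def)
qed

text \<open>
  The bound \<open>\<bar>H t - H a\<bar> \<le> \<epsilon> * (t - a)\<close> cannot start to fail anywhere, for any slope \<open>\<epsilon> > 0\<close>. Let
  \<open>c\<close> be the infimum of the points of failure. If the bound fails at \<open>c\<close> itself, then it holds at
  all earlier points, and it carries over to \<open>c\<close> either from the predecessor of \<open>c\<close> by the
  derivative there, or, if \<open>c\<close> is left-dense, by continuity. If it holds at \<open>c\<close>, then failures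
  accumulate at \<open>c\<close> from the right, against the derivative at the right-dense point \<open>c\<close>.
  Continuity is all that can be used in the left-dense case: if \<open>c\<close> is also right-scattered, the
  delta derivative at \<open>c\<close> does not bound the slope from the left.
\<close>
lemma zero_delta_derivative_imp_eq:
  assumes H: "\<And>t. t \<in> upper_kappa S \<Longrightarrow> has_delta_derivative S H 0 t"
  shows "H b = H a"
proof (rule ccontr)
  assume "H b \<noteq> H a"
  then have "a < b" using subset left_end by (cases "a = b") auto
  \<comment> \<open>Half of the slope of the chord, so that the bound fails at \<open>b\<close>.\<close>
  define \<epsilon> where "\<epsilon> = \<bar>H b - H a\<bar> / (2 * (b - a))"
  have \<epsilon>: "\<epsilon> > 0" using \<open>a < b\<close> \<open>H b \<noteq> H a\<close> by (simp add: \<epsilon>_def)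
  define K where "K t = \<bar>H t - H a\<bar> - \<epsilon> * (t - a)" for t
  define A where "A = {t \<in> S. K t > 0}"
  have "\<epsilon> * (b - a) = \<bar>H b - H a\<bar> / 2" using \<open>a < b\<close> by (auto simp: \<epsilon>_def divide_simps)
  then have "K b = \<bar>H b - H a\<bar> / 2" by (simp add: K_def)
  then have "b \<in> A" using \<open>H b \<noteq> H a\<close> right_end by (simp add: A_def)
  define c where "c = Inf A"
  have bdd: "bdd_below A" using subset by (intro bdd_belowI[of _ a]) (auto simp: A_def)
  have "c \<in> closure A" unfolding c_def using \<open>b \<in> A\<close> bdd by (intro closure_contains_Inf) auto
  moreover have "closure A \<subseteq> S" using closed by (intro closure_minimal) (auto simp: A_def)
  ultimately have "c \<in> S" by blast
  have below: "K s \<le> 0" if "s \<in> S" "s < c" for s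
    using that cInf_lower[OF _ bdd, of s] by (force simp: A_def c_def)
  have "K a = 0" by (simp add: K_def)
  have deriv: "\<exists>U. openin (top_of_set S) U \<and> t \<in> U \<and>
      (\<forall>s\<in>U. \<bar>H (forward_jump S t) - H s\<bar> \<le> \<eta> * \<bar>forward_jump S t - s\<bar>)"
    if "t \<in> upper_kappa S" "\<eta> > 0" for t \<eta>
    using H[OF that(1)] that(2) unfolding has_delta_derivative_def by simp
  show False
  proof (cases "K c > 0")
    case True
    then have "a < c" using \<open>K a = 0\<close> \<open>c \<in> S\<close> subset by (cases "a = c") auto
    show False
    proof (cases "\<exists>r<c. \<forall>s\<in>S. s < c \<longrightarrow> s \<le> r")
      case True
      then obtain r where r: "r < c" "\<And>s. s \<in> S \<Longrightarrow> s < c \<Longrightarrow> s \<le> r" by blast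
      \<comment> \<open>\<open>c\<close> is left-scattered with predecessor \<open>p\<close>.\<close>
      define p where "p = Sup (S \<inter> {..r})"
      have ne: "S \<inter> {..r} \<noteq> {}" using r(2)[OF left_end \<open>a < c\<close>] left_end by auto
      have bdda: "bdd_above (S \<inter> {..r})" by (rule bdd_aboveI[of _ r]) auto
      have "p \<in> S \<inter> {..r}" unfolding p_def
        by (rule closed_contains_Sup[OF ne bdda]) (use closed in auto)
      then have p: "p \<in> S" "p < c" using r by auto
      have "p < s \<longrightarrow> c \<le> s" if "s \<in> S" for s
        using cSup_upper[OF _ bdda, of s] r(2)[OF that] that unfolding p_def by force
      then have "c \<le> forward_jump S p"
        using p \<open>c \<in> S\<close> forward_jump_mem[of p] forward_jump_ge[of p]
        by (auto simp: forward_jump_def intro!: cInf_greatest)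
      with forward_jump_le[OF \<open>c \<in> S\<close> p(2)] have jump: "forward_jump S p = c" by simp
      have "p < b" using p \<open>c \<in> S\<close> subset by auto
      from deriv[OF upper_kappaI[OF p(1) this] \<epsilon>] have "\<bar>H c - H p\<bar> \<le> \<epsilon> * (c - p)"
        using p(2) by (auto simp: jump)
      moreover have "K p \<le> 0" using below p by blast
      ultimately have "K c \<le> 0" by (auto simp: K_def algebra_simps abs_if split: if_splits)
      with \<open>K c > 0\<close> show False by simp
    next
      case False
      then have dense: "\<exists>s\<in>S. r < s \<and> s < c" if "r < c" for r
        using that by (meson not_le)
      have kap: "c \<in> upper_kappa S" by (rule left_dense_upper_kappa[OF \<open>c \<in> S\<close> \<open>a < c\<close> dense])
      define \<sigma> where "\<sigma> = forward_jump S c"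
      have \<sigma>: "\<sigma> \<in> S" "c \<le> \<sigma>" using forward_jump_mem \<open>c \<in> S\<close> forward_jump_ge by (auto simp: \<sigma>_def)
      \<comment> \<open>The point \<open>c\<close> may be right-scattered, so both \<open>H s\<close> and \<open>H c\<close> are compared with \<open>H \<sigma>\<close>.
        With this \<open>\<eta>\<close> each comparison costs at most a quarter of the excess \<open>K c\<close>.\<close>
      define \<eta> where "\<eta> = K c / (4 * (b - a))"
      have "\<eta> > 0" using \<open>K c > 0\<close> \<open>a < b\<close> by (simp add: \<eta>_def)
      obtain U where U: "openin (top_of_set S) U" "c \<in> U"
        and U_bound: "\<And>s. s \<in> U \<Longrightarrow> \<bar>H \<sigma> - H s\<bar> \<le> \<eta> * \<bar>\<sigma> - s\<bar>"
        using deriv[OF kap \<open>\<eta> > 0\<close>] unfolding \<sigma>_def by blast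
      obtain d where d: "d > 0" "\<And>s. s \<in> S \<Longrightarrow> dist s c < d \<Longrightarrow> s \<in> U"
        using U unfolding openin_euclidean_subtopology_iff by blast
      obtain s where s: "s \<in> S" "c - d < s" "s < c" using dense[of "c - d"] d by auto
      have "s \<in> U" using s by (intro d(2)) (auto simp: dist_real_def)
      have "\<bar>\<sigma> - s\<bar> \<le> b - a" "\<bar>\<sigma> - c\<bar> \<le> b - a"
        using \<sigma>(2) s subsetD[OF subset \<sigma>(1)] subsetD[OF subset s(1)] by auto
      then have "\<eta> * \<bar>\<sigma> - s\<bar> \<le> \<eta> * (b - a)" "\<eta> * \<bar>\<sigma> - c\<bar> \<le> \<eta> * (b - a)"
        using \<open>\<eta> > 0\<close> by (auto intro!: mult_left_mono)
      moreover have "\<eta> * (b - a) = K c / 4" using \<open>a < b\<close> by (auto simp: \<eta>_def divide_simps)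
      ultimately have "\<bar>H c - H s\<bar> \<le> K c / 2"
        using U_bound[OF \<open>s \<in> U\<close>] U_bound[OF \<open>c \<in> U\<close>] by linarith
      moreover have "\<bar>H s - H a\<bar> \<le> \<epsilon> * (s - a)" using below[OF s(1,3)] by (simp add: K_def)
      moreover have "\<epsilon> * (s - a) \<le> \<epsilon> * (c - a)" using \<epsilon> s by (intro mult_left_mono) auto
      ultimately have "K c \<le> K c / 2" unfolding K_def by linarith
      with \<open>K c > 0\<close> show False by simp
    qed
  next
    case False
    have above: "\<exists>t\<in>A. c < t \<and> t < r" if "c < r" for r
    proof -
      have "A \<noteq> {}" "Inf A < r" using \<open>b \<in> A\<close> that by (auto simp: c_def)
      from cInf_lessD[OF this] obtain t where "t \<in> A" "t < r" by blast
      moreover have "c \<le> t" using \<open>t \<in> A\<close> bdd unfolding c_def by (rule cInf_lower)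
      moreover have "c \<noteq> t" using \<open>t \<in> A\<close> False by (auto simp: A_def)
      ultimately show ?thesis by force
    qed
    have "forward_jump S c \<le> c"
    proof (rule ccontr)
      assume "\<not> forward_jump S c \<le> c"
      then obtain t where "t \<in> A" "c < t" "t < forward_jump S c" using above by (meson not_le)
      then show False using forward_jump_le[of t c] by (auto simp: A_def)
    qed
    then have jump: "forward_jump S c = c" using forward_jump_ge[of c] by simp
    have "c < b" using above[of "c + 1"] subset by (auto simp: A_def)
    obtain U where U: "openin (top_of_set S) U" "c \<in> U"
      and U_bound: "\<And>s. s \<in> U \<Longrightarrow> \<bar>H c - H s\<bar> \<le> \<epsilon> * \<bar>c - s\<bar>"
      using deriv[OF upper_kappaI[OF \<open>c \<in> S\<close> \<open>c < b\<close>] \<epsilon>] unfolding jump by blast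
    obtain d where d: "d > 0" "\<And>s. s \<in> S \<Longrightarrow> dist s c < d \<Longrightarrow> s \<in> U"
      using U unfolding openin_euclidean_subtopology_iff by blast
    obtain t where t: "t \<in> A" "c < t" "t < c + d" using above[of "c + d"] d by auto
    have "t \<in> U" using t by (intro d(2)) (auto simp: dist_real_def A_def)
    then have "\<bar>H c - H t\<bar> \<le> \<epsilon> * (t - c)" using U_bound t by force
    with False have "K t \<le> 0" by (auto simp: K_def algebra_simps abs_if split: if_splits)
    with t show False by (simp add: A_def)
  qed
qed

definition last_point :: "real \<Rightarrow> real" where
  "last_point x = Sup (S \<inter> {..x})"

lemma last_point_upper: "s \<in> S \<Longrightarrow> s \<le> x \<Longrightarrow> s \<le> last_point x"
  unfolding last_point_def
  by (rule cSup_upper, blast) (rule bdd_aboveI[of _ x], blast)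

lemma last_point:
  assumes "a \<le> x" shows last_point_mem: "last_point x \<in> S" and last_point_le: "last_point x \<le> x"
proof -
  have "last_point x \<in> S \<inter> {..x}" unfolding last_point_def
    using left_end assms closed by (intro closed_contains_Sup) (auto intro!: bdd_aboveI[of _ x])
  then show "last_point x \<in> S" "last_point x \<le> x" by auto
qed

text \<open>
  The map to the last point is monotone, hence Borel measurable, so its composition with a
  continuous function is measurable; compactness of \<open>S\<close> gives boundedness.
\<close>
lemma integrable_last_point:
  fixes f :: "real \<Rightarrow> real"
  assumes f: "continuous_on S f"
  shows "(\<lambda>x. f (last_point x)) integrable_on {a..b}"
proof -
  have "mono_on {a..b} last_point"
    by (intro mono_onI) (auto intro!: last_point_upper last_point_mem intro: order_trans[OF last_point_le])
  then have "last_point \<in> borel_measurable (restrict_space borel {a..b})"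
    by (rule borel_measurable_mono_on_fnc)
  then have "last_point \<in> measurable (restrict_space borel {a..b}) (restrict_space borel S)"
    by (intro measurable_restrict_space2) (auto simp: space_restrict_space last_point_mem)
  from measurable_comp[OF this borel_measurable_continuous_on_restrict[OF f]]
  have borel: "(\<lambda>x. f (last_point x)) \<in> borel_measurable (restrict_space borel {a..b})"
    by (simp add: comp_def)
  have meas: "(\<lambda>x. f (last_point x)) \<in> borel_measurable (lebesgue_on {a..b})"
  proof (rule borel_measurable_subalgebra[OF _ _ borel])
    show "sets (restrict_space borel {a..b}) \<subseteq> sets (lebesgue_on {a..b})"
      unfolding sets_restrict_space by (intro image_mono subsetI sets_completionI_sets) simp
  qed (simp add: space_restrict_space)
  have "compact S" using closed subset by (metis compact_Icc compact_Int_closed inf.absorb2)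
  then have "bounded (f ` S)" using f by (intro compact_imp_bounded compact_continuous_image)
  then obtain B where B: "\<And>s. s \<in> S \<Longrightarrow> \<bar>f s\<bar> \<le> B" unfolding bounded_iff by auto
  show ?thesis
  proof (rule measurable_bounded_by_integrable_imp_integrable[OF meas])
    show "(\<lambda>_. B) integrable_on {a..b}" by (rule integrable_const_ivl)
    show "norm (f (last_point x)) \<le> B" if "x \<in> {a..b}" for x
      using B[OF last_point_mem[of x]] that by simp
  qed simp
qed

text \<open>
  Between a point \<open>s \<in> S\<close> close to \<open>t\<close> and the jump \<open>\<sigma>\<close> of \<open>t\<close>, the last point of \<open>S\<close> always lies
  between \<open>s\<close> and \<open>t\<close>, because no point of \<open>S\<close> lies strictly between \<open>t\<close> and \<open>\<sigma>\<close>. By continuity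
  the integrand is then uniformly close to \<open>f t\<close>.
\<close>
lemma delta_antiderivative_integral:
  assumes f: "continuous_on S f"
  shows "delta_antiderivative S (\<lambda>t. integral {a..t} (\<lambda>x. f (last_point x))) f"
  unfolding delta_antiderivative_def
proof
  fix t
  assume "t \<in> upper_kappa S"
  then have "t \<in> S" by (simp add: upper_kappa_def)
  define h where "h x = f (last_point x)" for x
  define F where "F t = integral {a..t} h" for t
  define \<sigma> where "\<sigma> = forward_jump S t"
  have \<sigma>: "\<sigma> \<in> S" "t \<le> \<sigma>" using \<open>t \<in> S\<close> by (auto simp: \<sigma>_def forward_jump_mem forward_jump_ge)
  have h: "h integrable_on {p..q}" if "p \<in> S" "q \<in> S" for p q
    unfolding h_def using that subset
    by (intro integrable_on_subinterval[OF integrable_last_point[OF f]]) auto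
  have F_diff: "F q - F p = integral {p..q} h" if "p \<in> S" "q \<in> S" "p \<le> q" for p q
  proof -
    have "a \<le> p" using that subset by auto
    from Henstock_Kurzweil_Integration.integral_combine[OF this \<open>p \<le> q\<close> h[OF left_end \<open>q \<in> S\<close>]]
    show ?thesis by (simp add: F_def)
  qed
  have "has_delta_derivative S F (f t) t"
    unfolding has_delta_derivative_def
  proof (intro allI impI)
    fix \<epsilon> :: real
    assume "\<epsilon> > 0"
    then obtain d where d: "d > 0" "\<And>u. u \<in> S \<Longrightarrow> dist u t < d \<Longrightarrow> dist (f u) (f t) < \<epsilon>"
      using f \<open>t \<in> S\<close> unfolding continuous_on_iff by blast
    \<comment> \<open>If \<open>t\<close> is right-scattered, this radius excludes all points to the right of \<open>t\<close>.\<close>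
    define d' where "d' = (if t < \<sigma> then min d (\<sigma> - t) else d)"
    have d': "d' > 0" "d' \<le> d" using d(1) by (auto simp: d'_def)
    have near: "\<bar>h x - f t\<bar> \<le> \<epsilon>" if "a \<le> x" "\<bar>last_point x - t\<bar> < d" for x
      using d(2)[OF last_point_mem[OF that(1)]] that(2) by (simp add: h_def dist_real_def)
    have "\<bar>F \<sigma> - F s - f t * (\<sigma> - s)\<bar> \<le> \<epsilon> * \<bar>\<sigma> - s\<bar>" if "s \<in> S \<inter> ball t d'" for s
    proof (cases "s \<le> t")
      case True
      have "s \<in> S" "\<bar>s - t\<bar> < d" using that d'(2) by (auto simp: dist_real_def)
      have "\<bar>h x - f t\<bar> \<le> \<epsilon>" if x: "s \<le> x" "x < \<sigma>" for x
      proof (rule near)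
        show "a \<le> x" using x \<open>s \<in> S\<close> subset by auto
        have "last_point x \<le> t"
          using forward_jump_le[OF last_point_mem[OF \<open>a \<le> x\<close>], of t] last_point_le[OF \<open>a \<le> x\<close>] x
          by (force simp: \<sigma>_def)
        then show "\<bar>last_point x - t\<bar> < d"
          using last_point_upper[OF \<open>s \<in> S\<close> x(1)] \<open>\<bar>s - t\<bar> < d\<close> by linarith
      qed
      from integral_near_constant[OF _ _ h this] show ?thesis
        using F_diff[of s \<sigma>] \<open>s \<in> S\<close> \<sigma> True \<open>\<epsilon> > 0\<close> by simp
    next
      case False
      then have "\<sigma> \<le> s" using that forward_jump_le[of s t] by (simp add: \<sigma>_def)
      have "\<sigma> = t" using that \<open>\<sigma> \<le> s\<close> \<sigma> by (auto simp: d'_def dist_real_def split: if_splits)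
      have "s \<in> S" "s - t < d" using that d'(2) by (auto simp: dist_real_def)
      have "\<bar>h x - f t\<bar> \<le> \<epsilon>" if x: "t \<le> x" "x < s" for x
      proof (rule near)
        show "a \<le> x" using x \<open>t \<in> S\<close> subset by auto
        show "\<bar>last_point x - t\<bar> < d"
          using last_point_upper[OF \<open>t \<in> S\<close> x(1)] last_point_le[OF \<open>a \<le> x\<close>] x \<open>s - t < d\<close>
          by linarith
      qed
      from integral_near_constant[OF _ _ h this]
      have "\<bar>F s - F t - f t * (s - t)\<bar> \<le> \<epsilon> * (s - t)"
        using F_diff[of t s] \<open>s \<in> S\<close> \<open>t \<in> S\<close> False \<open>\<epsilon> > 0\<close> by simp
      then show ?thesis using False \<open>\<sigma> = t\<close> by (simp add: algebra_simps abs_if split: if_splits)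
    qed
    moreover have "openin (top_of_set S) (S \<inter> ball t d')" by auto
    ultimately show "\<exists>U. openin (top_of_set S) U \<and> t \<in> U \<and>
        (\<forall>s\<in>U. \<bar>F (forward_jump S t) - F s - f t * (forward_jump S t - s)\<bar>
                 \<le> \<epsilon> * \<bar>forward_jump S t - s\<bar>)"
      using d' \<open>t \<in> S\<close> unfolding \<sigma>_def by (intro exI[of _ "S \<inter> ball t d'"]) auto
  qed
  then show "has_delta_derivative S (\<lambda>t. integral {a..t} (\<lambda>x. f (last_point x))) (f t) t"
    by (simp add: F_def[abs_def] h_def[abs_def])
qed

lemma delta_integral_eq:
  assumes "continuous_on S f"
  shows "delta_integral S a b f = integral {a..b} (\<lambda>x. f (last_point x))"
  unfolding delta_integral_def
proof (rule the_equality)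
  let ?F = "\<lambda>t. integral {a..t} (\<lambda>x. f (last_point x))"
  have F: "delta_antiderivative S ?F f" by (rule delta_antiderivative_integral[OF assms])
  then show "\<exists>F. delta_antiderivative S F f \<and> ?F b = F b - F a"
    by (intro exI[of _ ?F]) simp
  fix I
  assume "\<exists>F. delta_antiderivative S F f \<and> I = F b - F a"
  then obtain G where G: "delta_antiderivative S G f" "I = G b - G a" by blast
  have "has_delta_derivative S (\<lambda>x. G x - ?F x) 0 t" if "t \<in> upper_kappa S" for t
    using has_delta_derivative_diff[of S G "f t" t ?F "f t"] F G(1) that
    by (simp add: delta_antiderivative_def)
  from zero_delta_derivative_imp_eq[of "\<lambda>x. G x - ?F x", OF this] show "I = ?F b"
    using G(2) by simp
qed

end

section \<open>Reflection\<close>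

lemma forward_jump_reflect: "forward_jump (uminus ` S) (- t) = - backward_jump S t"
proof -
  have *: "{s \<in> uminus ` S. - t < s} = uminus ` {s \<in> S. s < t}" by force
  have "Inf (uminus ` X) = - Sup X" for X :: "real set"
    unfolding Inf_real_def by (simp add: image_image)
  then have "Inf {s \<in> uminus ` S. - t < s} = - Sup {s \<in> S. s < t}" by (simp add: *)
  moreover have "(\<forall>s\<in>uminus ` S. s \<le> - t) \<longleftrightarrow> (\<forall>s\<in>S. t \<le> s)" by simp
  ultimately show ?thesis unfolding forward_jump_def backward_jump_def
    by (simp only:) (simp only: if_distrib[of uminus])
qed

lemma backward_jump_reflect: "backward_jump (uminus ` S) (- t) = - forward_jump S t"
  using forward_jump_reflect[of "uminus ` S" "- t"] by (simp add: image_image)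

lemma upper_kappa_reflect: "upper_kappa (uminus ` S) = uminus ` lower_kappa S"
  by (auto simp: upper_kappa_def lower_kappa_def left_scattered_def right_scattered_def
      backward_jump_reflect)

text \<open>
  Reflecting the argument alone would change the sign of the derivative; the outer minus restores
  it, so that the integrand is only reflected.
\<close>
lemma has_nabla_derivative_reflect:
  "has_nabla_derivative S G D t \<longleftrightarrow>
   has_delta_derivative (uminus ` S) (\<lambda>x. - G (- x)) D (- t)" (is "?L \<longleftrightarrow> ?R")
proof -
  have open_reflect: "openin (top_of_set (uminus ` X)) (uminus ` U)"
    if "openin (top_of_set X) U" for X U :: "real set"
  proof -
    obtain W where "open W" "U = X \<inter> W"
      using \<open>openin (top_of_set X) U\<close> unfolding openin_open by blast
    then have "uminus ` U = uminus ` X \<inter> uminus ` W" by auto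
    then show ?thesis using open_negations[OF \<open>open W\<close>] by (auto simp: openin_open)
  qed
  have bound: "\<bar>- G (- (- r)) - (- G (- (- s))) - D * (- r - (- s))\<bar> \<le> \<epsilon> * \<bar>- r - (- s)\<bar> \<longleftrightarrow>
      \<bar>G r - G s - D * (r - s)\<bar> \<le> \<epsilon> * \<bar>r - s\<bar>" for r s \<epsilon>
    by (auto simp: algebra_simps abs_if)
  show ?thesis
  proof
    assume L: ?L
    show ?R unfolding has_delta_derivative_def
    proof (intro allI impI)
      fix \<epsilon> :: real assume "\<epsilon> > 0"
      with L obtain V where V: "openin (top_of_set S) V" "t \<in> V"
        "\<forall>s\<in>V. \<bar>G (backward_jump S t) - G s - D * (backward_jump S t - s)\<bar>
                 \<le> \<epsilon> * \<bar>backward_jump S t - s\<bar>"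
        unfolding has_nabla_derivative_def by blast
      then show "\<exists>U. openin (top_of_set (uminus ` S)) U \<and> - t \<in> U \<and>
        (\<forall>s\<in>U. \<bar>- G (- forward_jump (uminus ` S) (- t)) - (- G (- s))
           - D * (forward_jump (uminus ` S) (- t) - s)\<bar>
                 \<le> \<epsilon> * \<bar>forward_jump (uminus ` S) (- t) - s\<bar>)"
        unfolding forward_jump_reflect
        by (intro exI[of _ "uminus ` V"] conjI open_reflect) (auto simp only: bound)
    qed
  next
    assume R: ?R
    show ?L unfolding has_nabla_derivative_def
    proof (intro allI impI)
      fix \<epsilon> :: real assume "\<epsilon> > 0"
      with R obtain U where U: "openin (top_of_set (uminus ` S)) U" "- t \<in> U"
        "\<forall>s\<in>U. \<bar>- G (- (- backward_jump S t)) - (- G (- s)) - D * (- backward_jump S t - s)\<bar>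
                 \<le> \<epsilon> * \<bar>- backward_jump S t - s\<bar>"
        unfolding has_delta_derivative_def forward_jump_reflect by blast
      have "\<bar>G (backward_jump S t) - G s - D * (backward_jump S t - s)\<bar>
                 \<le> \<epsilon> * \<bar>backward_jump S t - s\<bar>" if "s \<in> uminus ` U" for s
        using U(3)[rule_format, of "- s"] that unfolding bound by auto
      moreover have "openin (top_of_set S) (uminus ` U)"
        using open_reflect[OF U(1)] by (simp add: image_image)
      ultimately show "\<exists>V. openin (top_of_set S) V \<and> t \<in> V \<and>
        (\<forall>s\<in>V. \<bar>G (backward_jump S t) - G s - D * (backward_jump S t - s)\<bar>
                 \<le> \<epsilon> * \<bar>backward_jump S t - s\<bar>)"
        using image_eqI[of t uminus "- t" U] U(2) by (intro exI[of _ "uminus ` U"]) auto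
    qed
  qed
qed

lemma nabla_antiderivative_reflect:
  "nabla_antiderivative S G f \<longleftrightarrow>
   delta_antiderivative (uminus ` S) (\<lambda>x. - G (- x)) (\<lambda>x. f (- x))"
  by (simp add: nabla_antiderivative_def delta_antiderivative_def upper_kappa_reflect
      has_nabla_derivative_reflect)

lemma nabla_integral_reflect:
  "nabla_integral S a b f = delta_integral (uminus ` S) (- b) (- a) (\<lambda>x. f (- x))"
proof -
  have "(\<exists>G. nabla_antiderivative S G f \<and> I = G b - G a) \<longleftrightarrow>
      (\<exists>F. delta_antiderivative (uminus ` S) F (\<lambda>x. f (- x)) \<and> I = F (- a) - F (- b))" for I
  proof
    assume "\<exists>G. nabla_antiderivative S G f \<and> I = G b - G a"
    then obtain G where "nabla_antiderivative S G f" "I = G b - G a" by blast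
    then show "\<exists>F. delta_antiderivative (uminus ` S) F (\<lambda>x. f (- x)) \<and> I = F (- a) - F (- b)"
      by (intro exI[of _ "\<lambda>x. - G (- x)"]) (simp add: nabla_antiderivative_reflect)
  next
    assume "\<exists>F. delta_antiderivative (uminus ` S) F (\<lambda>x. f (- x)) \<and> I = F (- a) - F (- b)"
    then obtain F where "delta_antiderivative (uminus ` S) F (\<lambda>x. f (- x))" "I = F (- a) - F (- b)"
      by blast
    then show "\<exists>G. nabla_antiderivative S G f \<and> I = G b - G a"
      by (intro exI[of _ "\<lambda>x. - F (- x)"]) (simp add: nabla_antiderivative_reflect)
  qed
  then show ?thesis by (simp add: nabla_integral_def delta_integral_def)
qed

lemma bounded_time_scale_reflect:
  assumes "bounded_time_scale S a b" shows "bounded_time_scale (uminus ` S) (- b) (- a)"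
  using assms by (auto simp: bounded_time_scale_def intro: closed_negations)

section \<open>Positive functionals\<close>

text \<open>
  An abstract expectation on the continuous functions on \<open>S\<close>. Only the values on \<open>S\<close> count, as
  positivity makes the functional insensitive to the others.
\<close>
locale positive_mean =
  fixes S :: "'a::topological_space set" and M :: "('a \<Rightarrow> real) \<Rightarrow> real"
  assumes add: "continuous_on S f \<Longrightarrow> continuous_on S g \<Longrightarrow> M (\<lambda>x. f x + g x) = M f + M g"
    and scale: "continuous_on S f \<Longrightarrow> M (\<lambda>x. c * f x) = c * M f"
    and nonneg: "continuous_on S f \<Longrightarrow> (\<And>x. x \<in> S \<Longrightarrow> 0 \<le> f x) \<Longrightarrow> 0 \<le> M f"
    and unit: "M (\<lambda>_. 1) = 1"
begin

definition covariance :: "('a \<Rightarrow> real) \<Rightarrow> ('a \<Rightarrow> real) \<Rightarrow> real" where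
  "covariance f g = M (\<lambda>x. f x * g x) - M f * M g"

lemma const: "M (\<lambda>_. c) = c"
  using scale[of "\<lambda>_. 1" c] unit by simp

text \<open>
  Nonnegativity of the mean of \<open>(hi - f) (f - lo)\<close> says that the variance is at most
  \<open>(hi - \<mu>) (\<mu> - lo)\<close> with \<open>\<mu>\<close> the mean of \<open>f\<close>; this product is largest when \<open>\<mu>\<close> is the midpoint.
\<close>
lemma variance_le:
  assumes f: "continuous_on S f" and bounds: "\<And>x. x \<in> S \<Longrightarrow> lo \<le> f x \<and> f x \<le> hi"
  shows "covariance f f \<le> (hi - lo)\<^sup>2 / 4"
proof -
  have "0 \<le> M (\<lambda>x. (hi - f x) * (f x - lo))"
    using f bounds by (intro nonneg continuous_intros) auto
  also have "(\<lambda>x. (hi - f x) * (f x - lo)) = (\<lambda>x. (hi + lo) * f x + ((- 1) * (f x * f x) + - hi * lo))"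
    by (simp add: algebra_simps)
  also have "M \<dots> = (hi + lo) * M f + ((- 1) * M (\<lambda>x. f x * f x) + - hi * lo)"
    using f by (simp only: add scale const continuous_intros)
  finally have "covariance f f \<le> (hi - M f) * (M f - lo)"
    by (simp add: covariance_def algebra_simps)
  also have "\<dots> \<le> (hi - lo)\<^sup>2 / 4"
    using zero_le_power2[of "hi + lo - 2 * M f"] by (simp add: power2_eq_square algebra_simps)
  finally show ?thesis .
qed

text \<open>
  The quadratic form is the variance of \<open>x f + y g\<close>, that is, the mean of a square.
\<close>
lemma covariance_quadratic_nonneg:
  assumes f: "continuous_on S f" and g: "continuous_on S g"
  shows "0 \<le> x\<^sup>2 * covariance f f + 2 * x * y * covariance f g + y\<^sup>2 * covariance g g"
proof -
  define k where "k = - (x * M f + y * M g)"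
  have "0 \<le> M (\<lambda>t. (x * f t + y * g t + k) * (x * f t + y * g t + k))"
    using f g by (intro nonneg continuous_intros) auto
  also have "(\<lambda>t. (x * f t + y * g t + k) * (x * f t + y * g t + k)) =
    (\<lambda>t. x\<^sup>2 * (f t * f t) + (2 * x * y * (f t * g t) + (y\<^sup>2 * (g t * g t)
       + (2 * k * x * f t + (2 * k * y * g t + k\<^sup>2)))))"
    by (simp add: algebra_simps power2_eq_square)
  also have "M \<dots> = x\<^sup>2 * M (\<lambda>t. f t * f t) + (2 * x * y * M (\<lambda>t. f t * g t) + (y\<^sup>2 * M (\<lambda>t. g t * g t)
       + (2 * k * x * M f + (2 * k * y * M g + k\<^sup>2))))"
    using f g by (simp only: add scale const continuous_intros)
  finally show ?thesis
    by (simp add: covariance_def k_def algebra_simps power2_eq_square)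
qed

lemma covariance_Cauchy_Schwarz:
  assumes f: "continuous_on S f" and g: "continuous_on S g"
  shows "(covariance f g)\<^sup>2 \<le> covariance f f * covariance g g"
proof -
  define A B C where "A = covariance f f" and "B = covariance g g" and "C = covariance f g"
  have Q: "0 \<le> x\<^sup>2 * A + 2 * x * y * C + y\<^sup>2 * B" for x y
    unfolding A_def B_def C_def by (rule covariance_quadratic_nonneg[OF f g])
  have "B \<ge> 0" using Q[of 0 1] by simp
  have "C\<^sup>2 \<le> A * B"
  proof (cases "B = 0")
    case True
    \<comment> \<open>The form is then affine in \<open>y\<close>; this \<open>y\<close> gives it the value \<open>- C\<^sup>2\<close> at \<open>x = - C\<close>.\<close>
    have "(- C)\<^sup>2 * A + 2 * (- C) * ((A + 1) / 2) * C = - C\<^sup>2"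
      by (simp add: field_simps power2_eq_square)
    then show ?thesis using Q[of "- C" "(A + 1) / 2"] True by simp
  next
    case False
    \<comment> \<open>At \<open>(B, - C)\<close> the form is \<open>B\<close> times its determinant \<open>A * B - C\<^sup>2\<close>.\<close>
    have "0 \<le> B * (A * B - C\<^sup>2)" using Q[of B "- C"] by (simp add: algebra_simps power2_eq_square)
    with False \<open>B \<ge> 0\<close> show ?thesis by (simp add: zero_le_mult_iff)
  qed
  then show ?thesis by (simp add: A_def B_def C_def)
qed

theorem Gruess:
  assumes f: "continuous_on S f" and g: "continuous_on S g"
    and fb: "\<And>x. x \<in> S \<Longrightarrow> lo \<le> f x \<and> f x \<le> hi"
    and gb: "\<And>x. x \<in> S \<Longrightarrow> lo' \<le> g x \<and> g x \<le> hi'" and "S \<noteq> {}"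
  shows "\<bar>covariance f g\<bar> \<le> (hi - lo) * (hi' - lo') / 4"
proof -
  have "lo \<le> hi" "lo' \<le> hi'" using fb gb \<open>S \<noteq> {}\<close> by force+
  have "(covariance f g)\<^sup>2 \<le> covariance f f * covariance g g"
    by (rule covariance_Cauchy_Schwarz[OF f g])
  also have "\<dots> \<le> (hi - lo)\<^sup>2 / 4 * ((hi' - lo')\<^sup>2 / 4)"
    using variance_le[OF f fb] variance_le[OF g gb] covariance_quadratic_nonneg[OF f g, of 0 1]
    by (intro mult_mono) auto
  also have "\<dots> = ((hi - lo) * (hi' - lo') / 4)\<^sup>2" by (simp add: power2_eq_square)
  finally show ?thesis using \<open>lo \<le> hi\<close> \<open>lo' \<le> hi'\<close>
    by (intro power2_le_imp_le[of "\<bar>_\<bar>", simplified]) auto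
qed

end

section \<open>The diamond integral as a positive functional\<close>

lemma (in bounded_time_scale) delta_mean:
  assumes "a < b"
  shows "positive_mean S (\<lambda>f. delta_integral S a b f / (b - a))"
proof
  fix f g :: "real \<Rightarrow> real" and c :: real
  assume f: "continuous_on S f"
  note I = integrable_last_point
  show "delta_integral S a b (\<lambda>x. c * f x) / (b - a) = c * (delta_integral S a b f / (b - a))"
    using f by (simp add: delta_integral_eq continuous_intros)
  { assume g: "continuous_on S g"
    show "delta_integral S a b (\<lambda>x. f x + g x) / (b - a)
      = delta_integral S a b f / (b - a) + delta_integral S a b g / (b - a)"
      using f g I[OF f] I[OF g]
      by (simp add: delta_integral_eq continuous_intros integral_add add_divide_distrib) }
  { assume "\<And>x. x \<in> S \<Longrightarrow> 0 \<le> f x"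
    then have "0 \<le> integral {a..b} (\<lambda>x. f (last_point x))"
      by (intro integral_nonneg I[OF f]) (auto simp: last_point_mem)
    then show "0 \<le> delta_integral S a b f / (b - a)"
      using f \<open>a < b\<close> by (simp add: delta_integral_eq) }
next
  show "delta_integral S a b (\<lambda>_. 1) / (b - a) = 1"
    using \<open>a < b\<close> by (simp add: delta_integral_eq)
qed

lemma nabla_mean:
  assumes S: "bounded_time_scale S a b" and "a < b"
  shows "positive_mean S (\<lambda>f. nabla_integral S a b f / (b - a))"
proof -
  interpret R: positive_mean "uminus ` S"
      "\<lambda>f. delta_integral (uminus ` S) (- b) (- a) f / (- a - - b)"
    by (rule bounded_time_scale.delta_mean[OF bounded_time_scale_reflect[OF S]])
       (use \<open>a < b\<close> in simp)
  have c: "continuous_on (uminus ` S) (\<lambda>x. f (- x))" if "continuous_on S f" for f :: "real \<Rightarrow> real"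
    by (rule continuous_on_compose2[OF that]) (auto intro!: continuous_intros)
  show ?thesis
  unfolding nabla_integral_reflect
  proof (unfold_locales, goal_cases)
    case (1 f g)
    from R.add[OF c[OF 1(1)] c[OF 1(2)]] show ?case by simp
  next
    case (2 f k)
    from R.scale[OF c[OF 2], of k] show ?case by simp
  next
    case (3 f)
    have "0 \<le> f (- x)" if "x \<in> uminus ` S" for x using 3(2) that by auto
    from R.nonneg[OF c[OF 3(1)] this] show ?case by simp
  next
    case 4
    from R.unit show ?case by simp
  qed
qed

lemma positive_mean_convex:
  assumes "positive_mean S M" and "positive_mean S N" and "0 \<le> \<alpha>" and "\<alpha> \<le> 1"
  shows "positive_mean S (\<lambda>f. \<alpha> * M f + (1 - \<alpha>) * N f)"
proof -
  interpret M: positive_mean S M by fact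
  interpret N: positive_mean S N by fact
  show ?thesis
  proof
    fix f :: "'a \<Rightarrow> real"
    assume f: "continuous_on S f" "\<And>x. x \<in> S \<Longrightarrow> 0 \<le> f x"
    show "0 \<le> \<alpha> * M f + (1 - \<alpha>) * N f"
      using M.nonneg[OF f] N.nonneg[OF f] assms(3,4) by simp
  qed (simp_all add: M.add N.add M.scale N.scale M.unit N.unit algebra_simps)
qed

theorem theorem3p4:
  fixes \<alpha> a b \<phi> \<Phi> \<gamma> \<Gamma> :: real and T :: "real set" and f g :: "real \<Rightarrow> real"
  assumes "0 \<le> \<alpha>" and "\<alpha> \<le> 1"
    and "time_scale T" and "a \<in> T" and "b \<in> T" and "a < b"
    and "continuous_on ({a..b} \<inter> T) f" and "continuous_on ({a..b} \<inter> T) g"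
    and "\<And>t. t \<in> {a..b} \<inter> T \<Longrightarrow> \<phi> \<le> f t \<and> f t \<le> \<Phi>"
    and "\<And>t. t \<in> {a..b} \<inter> T \<Longrightarrow> \<gamma> \<le> g t \<and> g t \<le> \<Gamma>"
  shows "\<bar>1 / (b - a) * diamond_integral \<alpha> ({a..b} \<inter> T) a b (\<lambda>t. f t * g t)
          - 1 / (b - a)\<^sup>2 * diamond_integral \<alpha> ({a..b} \<inter> T) a b f
                          * diamond_integral \<alpha> ({a..b} \<inter> T) a b g\<bar>
         \<le> 1 / 4 * (\<Phi> - \<phi>) * (\<Gamma> - \<gamma>)"
proof -
  define S where "S = {a..b} \<inter> T"
  have S: "bounded_time_scale S a b"
    using assms(3-6) by (auto simp: bounded_time_scale_def S_def time_scale_def)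
  have "positive_mean S (\<lambda>h. \<alpha> * (delta_integral S a b h / (b - a))
                            + (1 - \<alpha>) * (nabla_integral S a b h / (b - a)))"
    using assms(1,2,6) S
    by (intro positive_mean_convex bounded_time_scale.delta_mean nabla_mean)
  also have "(\<lambda>h. \<alpha> * (delta_integral S a b h / (b - a))
                + (1 - \<alpha>) * (nabla_integral S a b h / (b - a)))
      = (\<lambda>h. diamond_integral \<alpha> S a b h / (b - a))"
    by (simp add: diamond_integral_def add_divide_distrib)
  finally interpret D: positive_mean S "\<lambda>h. diamond_integral \<alpha> S a b h / (b - a)" .
  have "a \<in> S" using assms(4,6) by (simp add: S_def)
  then have "S \<noteq> {}" by blast
  from D.Gruess[OF assms(7-10)[folded S_def] this] show ?thesis
    unfolding S_def[symmetric] D.covariance_def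
    by (simp add: power2_eq_square)
qed

end
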